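(* Let $F$ be a Boolean formula in conjunctive normal form with (finite) variable set $V$. For a valid partial assignment $\boldsymbol{b}$ of $F$, let $S(\boldsymbol{b})$ and $U(\boldsymbol{b})$ denote the sets of star and unconstrained variables of $\boldsymbol{b}$ in $F$, respectively. Let $p_i$ and $q_i$ ($i \in V$) be real numbers such that $p_i + q_i = 1$ for all $i \in V$. Then, for any satisfying assignment $\boldsymbol{a} \in \{0,1\}^V$ of $F$, $$\sum_{\boldsymbol{b} \leq \boldsymbol{a}} \ \prod_{i \in S(\boldsymbol{b})} p_i \prod_{j \in U(\boldsymbol{b})} q_j = 1,$$ where the sum is over all valid partial assignments $\boldsymbol{b}$ of $F$ with $\boldsymbol{b} \leq \boldsymbol{a}$ in the poset $P(F)$.
   Context: $F$ is a conjunction of finitely many clauses; each clause is a disjunction of finitely many distinct literals, where a literal is a variable of $V$ or its negation. A partial assignment is an element $\boldsymbol{x} \in \{0, 1, *\}^V$, where $*$ means unassigned. Plugging $\boldsymbol{x}$ into a clause gives each literal a value: a literal on a variable with value $*$ gets the value $*$, and otherwise literals are evaluated as usual. $\boldsymbol{x}$ is invalid for a clause if either all literals of the clause get value $0$, or exactly one literal gets value $*$ and all other literals get value $0$. $\boldsymbol{x}$ is valid for $F$ if it is not invalid for any clause of $F$. In particular, an assignment in $\{0,1\}^V$ is valid if and only if it satisfies $F$. The poset $P(F)$ has as elements the valid partial assignments of $F$, where $\boldsymbol{a}$ covers $\boldsymbol{b}$ if $\boldsymbol{b}$ is obtained from $\boldsymbol{a}$ by switching exactly one coordinate with value $0$ or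 $1$ to $*$; the order $\leq$ is the reflexive transitive closure of this relation (so all intermediate partial assignments must be valid). For a valid partial assignment $\boldsymbol{b}$, a variable $i \in V$ is a star variable if $b_i = *$. It is unconstrained if $b_i \in \{0, 1\}$ and changing $b_i$ to $*$ gives a valid partial assignment. *)

theory Defs
  imports Complex_Main
begin

datatype 'v literal = Pos (lit_var: 'v) | Neg (lit_var: 'v)

type_synonym 'v clause = "'v literal set"

type_synonym 'v cnf = "'v clause set"

text \<open>The variables occurring in the formula need not exhaust \<open>V\<close>. Clauses may be empty and may
  contain both literals of one variable.\<close>

definition cnf_over :: "'v set \<Rightarrow> 'v cnf \<Rightarrow> bool" where
  "cnf_over V F \<longleftrightarrow> finite F \<and> (\<forall>C\<in>F. finite C \<and> lit_var ` C \<subseteq> V)"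

text \<open>An element of \<open>{0, 1, *}\<^sup>V\<close> is represented by a map with domain contained in \<open>V\<close>:
  for \<open>i \<in> V\<close>, the value \<open>None\<close> stands for \<open>*\<close>. Outside \<open>V\<close> the value is always \<open>None\<close> (so that the
  representation is unique) and carries no meaning; in particular such \<open>i\<close> are not star variables.\<close>

type_synonym 'v passign = "'v \<Rightarrow> bool option"

definition partial_assignments :: "'v set \<Rightarrow> 'v passign set" where
  "partial_assignments V = {x. dom x \<subseteq> V}"

definition total_assignments :: "'v set \<Rightarrow> 'v passign set" where
  "total_assignments V = {x. dom x = V}"

fun lit_value :: "'v passign \<Rightarrow> 'v literal \<Rightarrow> bool option" where
  "lit_value x (Pos i) = x i"
| "lit_value x (Neg i) = map_option Not (x i)"

definition satisfies :: "'v passign \<Rightarrow> 'v cnf \<Rightarrow> bool" where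
  "satisfies x F \<longleftrightarrow> (\<forall>C\<in>F. \<exists>l\<in>C. lit_value x l = Some True)"

definition invalid_for_clause :: "'v passign \<Rightarrow> 'v clause \<Rightarrow> bool" where
  "invalid_for_clause x C \<longleftrightarrow>
     (\<forall>l\<in>C. lit_value x l = Some False) \<or>
     (\<exists>l\<in>C. lit_value x l = None \<and> (\<forall>l'\<in>C - {l}. lit_value x l' = Some False))"

definition valid :: "'v set \<Rightarrow> 'v cnf \<Rightarrow> 'v passign \<Rightarrow> bool" where
  "valid V F x \<longleftrightarrow> x \<in> partial_assignments V \<and> (\<forall>C\<in>F. \<not> invalid_for_clause x C)"

definition covers :: "'v set \<Rightarrow> 'v cnf \<Rightarrow> 'v passign \<Rightarrow> 'v passign \<Rightarrow> bool" where
  "covers V F a b \<longleftrightarrow>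
     valid V F a \<and> valid V F b \<and> (\<exists>i\<in>V. a i \<noteq> None \<and> b = a(i := None))"

text \<open>The order of the poset \<open>P(F)\<close>; it is meant to be used between valid partial assignments
  (outside of these it is just equality).\<close>

definition P_le :: "'v set \<Rightarrow> 'v cnf \<Rightarrow> 'v passign \<Rightarrow> 'v passign \<Rightarrow> bool" where
  "P_le V F b a \<longleftrightarrow> (\<lambda>x y. covers V F y x)\<^sup>*\<^sup>* b a"

definition star_vars :: "'v set \<Rightarrow> 'v passign \<Rightarrow> 'v set" where
  "star_vars V b = {i \<in> V. b i = None}"

definition unconstrained_vars :: "'v set \<Rightarrow> 'v cnf \<Rightarrow> 'v passign \<Rightarrow> 'v set" where
  "unconstrained_vars V F b = {i \<in> V. b i \<noteq> None \<and> valid V F (b(i := None))}"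

lemma finite_valid: "finite V \<Longrightarrow> finite {b. valid V F b}"
proof -
  assume "finite V"
  have "{b. valid V F b} \<subseteq> (\<Union>D\<in>Pow V. {b. dom b = D \<and> ran b \<subseteq> (UNIV :: bool set)})"
    by (auto simp: valid_def partial_assignments_def)
  moreover have "finite {b. dom b = D \<and> ran b \<subseteq> (UNIV :: bool set)}" if "D \<in> Pow V" for D
    using \<open>finite V\<close> that finite_set_of_finite_maps[of D "UNIV :: bool set"]
    by (meson PowD finite finite_subset)
  then have "finite (\<Union>D\<in>Pow V. {b. dom b = D \<and> ran b \<subseteq> (UNIV :: bool set)})"
    using \<open>finite V\<close> by blast
  ultimately show ?thesis by (rule finite_subset)
qed

lemma total_valid_iff_satisfies:
  assumes "cnf_over V F" "a \<in> total_assignments V"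
  shows "valid V F a \<longleftrightarrow> satisfies a F"
proof -
  have assigned: "lit_value a l \<noteq> None" if "C \<in> F" "l \<in> C" for C l
  proof -
    have "lit_var l \<in> dom a"
      using assms that by (auto simp: cnf_over_def total_assignments_def)
    then show ?thesis by (cases l) auto
  qed
  have "\<not> invalid_for_clause a C \<longleftrightarrow> (\<exists>l\<in>C. lit_value a l = Some True)" if "C \<in> F" for C
  proof -
    have "lit_value a l = Some False \<longleftrightarrow> lit_value a l \<noteq> Some True" if "l \<in> C" for l
      using assigned[OF \<open>C \<in> F\<close> that] by (cases "lit_value a l") auto
    then show ?thesis
      using assigned[OF that] unfolding invalid_for_clause_def by blast
  qed
  then show ?thesis
    using assms(2)
    by (auto simp: valid_def satisfies_def partial_assignments_def total_assignments_def)
qed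

end

(* The star sets of the partial assignments below a form an antimatroid: once a variable can be
   turned into a star, it stays so until this is done. Hence every T \<subseteq> V contains a unique feasible
   set S that has no feasible one-point extension inside T. Expanding 1 = \<Prod>i\<in>V. (p i + q i) over
   all T and grouping the terms by this S gives the sum. *)

theory Submission imports Defs begin

section \<open>Antimatroids and their weighted sum over feasible sets\<close>

text \<open>Given accessibility, \<open>extension\<close> is equivalent to closure under union, the
  more usual axiom. It is the form that the star sets satisfy directly.\<close>

locale antimatroid =
  fixes V :: "'v set" and \<F> :: "'v set set"
  assumes finite_ground: "finite V"
    and feasible_subset: "S \<in> \<F> \<Longrightarrow> S \<subseteq> V"
    and empty_feasible: "{} \<in> \<F>"
    and accessible: "S \<in> \<F> \<Longrightarrow> S \<noteq> {} \<Longrightarrow> \<exists>i\<in>S. S - {i} \<in> \<F>"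
    and extension: "S \<in> \<F> \<Longrightarrow> S' \<in> \<F> \<Longrightarrow> S \<subseteq> S' \<Longrightarrow> insert i S \<in> \<F> \<Longrightarrow> insert i S' \<in> \<F>"
begin

text \<open>For the star set of a partial assignment these will be its unconstrained
  variables.\<close>

definition extensions :: "'v set \<Rightarrow> 'v set" where
  "extensions S = {i \<in> V - S. insert i S \<in> \<F>}"

lemma finite_feasible: "finite \<F>"
proof (rule finite_subset)
  show "\<F> \<subseteq> Pow V" using feasible_subset by blast
qed (simp add: finite_ground)

text \<open>Remove from \<open>X\<close> an element \<open>i\<close> that leaves it feasible. By
  induction the rest lies in \<open>S\<close>, so \<open>extension\<close> carries \<open>i\<close>
  over to \<open>S\<close>; were \<open>i\<close> not in \<open>S\<close>, it would be an extension
  of \<open>S\<close> inside \<open>T\<close>.\<close>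

lemma feasible_subset_of_unextendable:
  assumes "S \<in> \<F>" "extensions S \<inter> T = {}" "X \<in> \<F>" "X \<subseteq> T"
  shows "X \<subseteq> S"
proof -
  have "finite X" using feasible_subset[OF assms(3)] finite_ground by (rule finite_subset)
  then show ?thesis using assms(3,4)
  proof (induction X rule: finite_psubset_induct)
    case (psubset X)
    show ?case
    proof (cases "X = {}")
      case False
      then obtain i where i: "i \<in> X" "X - {i} \<in> \<F>" using accessible psubset.prems by blast
      have sub: "X - {i} \<subseteq> S" using psubset.IH[of "X - {i}"] psubset.prems i by blast
      have "insert i (X - {i}) \<in> \<F>" using i psubset.prems by (simp add: insert_absorb)
      then have "insert i S \<in> \<F>" using extension[OF i(2) assms(1) sub] by blast
      then have "i \<in> S"
        using assms(2) i(1) psubset.prems feasible_subset[of X] by (auto simp: extensions_def)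
      then show ?thesis using sub by blast
    qed simp
  qed
qed

text \<open>An inclusion-maximal feasible subset of \<open>T\<close> has the property, and two sets
  with the property contain each other by the preceding lemma. The set is thus the greatest feasible
  subset of \<open>T\<close>.\<close>

lemma ex1_unextendable:
  "\<exists>!S. S \<in> \<F> \<and> S \<subseteq> T \<and> extensions S \<inter> T = {}"
proof -
  have "finite {S \<in> \<F>. S \<subseteq> T}" "{S \<in> \<F>. S \<subseteq> T} \<noteq> {}"
    using finite_feasible empty_feasible by auto
  then obtain S where S: "S \<in> \<F>" "S \<subseteq> T" and max: "\<And>X. X \<in> \<F> \<Longrightarrow> X \<subseteq> T \<Longrightarrow> S \<subseteq> X \<Longrightarrow> S = X"
    using finite_has_maximal[of "{S \<in> \<F>. S \<subseteq> T}"] by auto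
  have "extensions S \<inter> T = {}"
    using max[of "insert _ S"] S by (auto simp: extensions_def)
  then show ?thesis
    using S feasible_subset_of_unextendable by (intro ex1I[of _ S]) blast+
qed

lemma sum_prod_extensions:
  fixes p q :: "'v \<Rightarrow> 'a::comm_ring_1"
  assumes "\<And>i. i \<in> V \<Longrightarrow> p i + q i = 1"
  shows "(\<Sum>S\<in>\<F>. prod p S * prod q (extensions S)) = 1"
proof -
  \<comment> \<open>\<open>\<T> S\<close> is the interval from \<open>S\<close> to
    \<open>V - extensions S\<close>: the sets \<open>T\<close> whose greatest feasible subset is
    \<open>S\<close>. \<open>w T\<close> is the term of the expanded product that takes
    \<open>p\<close> on \<open>T\<close> and \<open>q\<close> elsewhere.\<close>
  define \<T> where "\<T> S = {T \<in> Pow V. S \<subseteq> T \<and> extensions S \<inter> T = {}}" for S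
  define w where "w T = prod p T * prod q (V - T)" for T
  have term_eq: "prod p S * prod q (extensions S) = sum w (\<T> S)" if S: "S \<in> \<F>" for S
  proof -
    \<comment> \<open>\<open>R\<close> holds the elements on which members of \<open>\<T> S\<close>
      may differ freely; its factors \<open>p i + q i\<close> contribute 1.\<close>
    define R where "R = V - S - extensions S"
    have fin: "finite S" "finite (extensions S)" "finite R"
      using finite_ground feasible_subset[OF S] finite_subset
      by (auto simp: R_def extensions_def)
    have "1 = (\<Prod>i\<in>R. p i + q i)" using assms by (simp add: R_def)
    also have "\<dots> = (\<Sum>X\<in>Pow R. prod p X * prod q (R - X))"
      using fin by (rule_tac prod_add)
    finally have "prod p S * prod q (extensions S)
        = (\<Sum>X\<in>Pow R. prod p S * prod q (extensions S) * (prod p X * prod q (R - X)))"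
      by (simp flip: sum_distrib_left)
    also have "\<dots> = (\<Sum>X\<in>Pow R. w (S \<union> X))"
    proof (rule sum.cong)
      fix X assume X: "X \<in> Pow R"
      have "V - (S \<union> X) = extensions S \<union> (R - X)"
        using X feasible_subset[OF S] by (auto simp: R_def extensions_def)
      moreover have "S \<inter> X = {}" "extensions S \<inter> (R - X) = {}" "finite X"
        using X fin(3) by (auto simp: R_def intro: finite_subset)
      ultimately show "prod p S * prod q (extensions S) * (prod p X * prod q (R - X)) = w (S \<union> X)"
        using fin by (simp add: w_def prod.union_disjoint)
    qed simp
    also have "\<dots> = sum w (\<T> S)"
      using feasible_subset[OF S]
      by (intro sum.reindex_bij_witness[where i = "\<lambda>T. T - S" and j = "\<lambda>X. S \<union> X"])
        (auto simp: \<T>_def R_def extensions_def)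
    finally show ?thesis .
  qed
  \<comment> \<open>The intervals partition \<open>Pow V\<close>: uniqueness in
    \<open>ex1_unextendable\<close> makes them disjoint, existence makes them cover.\<close>
  have "(\<Sum>S\<in>\<F>. sum w (\<T> S)) = sum w (\<Union>S\<in>\<F>. \<T> S)"
  proof (rule sum.UNION_disjoint[symmetric])
    show "\<forall>S\<in>\<F>. finite (\<T> S)" using finite_ground by (simp add: \<T>_def)
    show "\<forall>S\<in>\<F>. \<forall>S'\<in>\<F>. S \<noteq> S' \<longrightarrow> \<T> S \<inter> \<T> S' = {}"
    proof (intro ballI impI equals0I)
      fix S S' T
      assume "S \<in> \<F>" "S' \<in> \<F>" "S \<noteq> S'" "T \<in> \<T> S \<inter> \<T> S'"
      then show False using ex1_unextendable[of T] by (auto simp: \<T>_def)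
    qed
  qed (rule finite_feasible)
  also have "(\<Union>S\<in>\<F>. \<T> S) = Pow V"
  proof
    show "Pow V \<subseteq> (\<Union>S\<in>\<F>. \<T> S)"
    proof
      fix T assume "T \<in> Pow V"
      then show "T \<in> (\<Union>S\<in>\<F>. \<T> S)"
        using ex1_unextendable[of T] by (auto simp: \<T>_def)
    qed
  qed (auto simp: \<T>_def)
  also have "sum w (Pow V) = (\<Prod>i\<in>V. p i + q i)"
    unfolding w_def using finite_ground by (rule prod_add[symmetric])
  also have "\<dots> = 1" using assms by simp
  finally show ?thesis using term_eq by simp
qed

end

section \<open>Validity and order under starring a variable\<close>

lemma lit_value_fun_upd_other: "lit_var l \<noteq> i \<Longrightarrow> lit_value (x(i := y)) l = lit_value x l"
  by (cases l) auto

lemma lit_value_fun_upd_None: "lit_var l = i \<Longrightarrow> lit_value (x(i := None)) l = None"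
  by (cases l) auto

lemma lit_value_map_le: "b \<subseteq>\<^sub>m c \<Longrightarrow> lit_value b l = Some v \<Longrightarrow> lit_value c l = Some v"
  by (cases l) (fastforce simp: map_le_def dom_def)+

text \<open>This is the source of \<open>extension\<close>. Suppose starring \<open>i\<close> in
  \<open>b\<close> makes a clause invalid. If its one unassigned literal is on \<open>i\<close>, the
  other literals are false in \<open>c\<close> too, so starring \<open>i\<close> in \<open>c\<close>
  fails as well. Otherwise the clause does not mention \<open>i\<close> and was already invalid for
  \<open>b\<close>.\<close>

lemma valid_star_map_le:
  assumes b: "valid V F b" and le: "b \<subseteq>\<^sub>m c" and c: "valid V F (c(i := None))"
  shows "valid V F (b(i := None))"
proof -
  have "\<not> invalid_for_clause (b(i := None)) C" if C: "C \<in> F" for C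
  proof
    let ?b = "b(i := None)" and ?c = "c(i := None)"
    assume inv: "invalid_for_clause ?b C"
    have "?b \<subseteq>\<^sub>m ?c" using le by (auto simp: map_le_def)
    note mono = lit_value_map_le[OF this]
    have nc: "\<not> invalid_for_clause ?c C" and nb: "\<not> invalid_for_clause b C"
      using b c C by (auto simp: valid_def)
    \<comment> \<open>If all literals were false after starring \<open>i\<close> in
      \<open>b\<close>, they would be false after starring \<open>i\<close> in \<open>c\<close>;
      this leaves the case of exactly one unassigned literal.\<close>
    obtain l where l: "l \<in> C" "\<forall>l'\<in>C - {l}. lit_value ?b l' = Some False"
      using inv nc mono unfolding invalid_for_clause_def by blast
    show False
    proof (cases "lit_var l = i")
      case True
      then have "lit_value ?c l = None" by (rule lit_value_fun_upd_None)
      then show False using l mono nc unfolding invalid_for_clause_def by blast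
    next
      case False
      have "lit_var l' \<noteq> i" if "l' \<in> C" for l'
        using that l False lit_value_fun_upd_None[of l' i b] by force
      then have "lit_value ?b l' = lit_value b l'" if "l' \<in> C" for l'
        using that by (simp add: lit_value_fun_upd_other)
      then show False using inv nb unfolding invalid_for_clause_def by fastforce
    qed
  qed
  then show ?thesis
    using b by (auto simp: valid_def partial_assignments_def)
qed

lemma P_le_valid: "P_le V F b a \<Longrightarrow> valid V F a \<Longrightarrow> valid V F b"
  unfolding P_le_def by (induction rule: converse_rtranclp_induct) (auto simp: covers_def)

lemma P_le_map_le: "P_le V F b a \<Longrightarrow> b \<subseteq>\<^sub>m a"
  unfolding P_le_def
  by (induction rule: converse_rtranclp_induct) (auto simp: covers_def map_le_def dom_def split: if_splits)

lemma P_le_star: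
  assumes "P_le V F b a" "valid V F b" "valid V F (b(i := None))"
  shows "P_le V F (b(i := None)) a"
proof (cases "b i = None")
  case True
  then show ?thesis using assms(1) by (metis fun_upd_triv)
next
  case False
  then have "i \<in> V" using assms(2) by (auto simp: valid_def partial_assignments_def)
  then have "covers V F b (b(i := None))" using assms False by (auto simp: covers_def)
  then show ?thesis
    using assms(1) unfolding P_le_def by (metis (mono_tags) converse_rtranclp_into_rtranclp)
qed

section \<open>The antimatroid of star sets below a satisfying assignment\<close>

locale satisfying_assignment =
  fixes V :: "'v set" and F :: "'v cnf" and a :: "'v passign"
  assumes finite_V: "finite V" and total: "dom a = V" and valid_a: "valid V F a"
begin

text \<open>Any \<open>b\<close> below \<open>a\<close> agrees with \<open>a\<close> wherever it is
  assigned, so it can be recovered from its star set; \<open>starred\<close> does this.\<close>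

definition starred :: "'v set \<Rightarrow> 'v passign" where
  "starred S = a |` (V - S)"

text \<open>The condition asks for a chain of valid assignments up to \<open>a\<close>, not merely
  for validity of \<open>starred S\<close>; accessibility comes from this chain.\<close>

definition star_sets :: "'v set set" where
  "star_sets = {S. S \<subseteq> V \<and> P_le V F (starred S) a}"

lemma starred_insert: "starred (insert i S) = (starred S)(i := None)"
  by (auto simp: starred_def restrict_map_def)

lemma starred_empty: "starred {} = a"
  using total by (auto simp: starred_def restrict_map_def fun_eq_iff dom_def)

lemma star_vars_starred: "S \<subseteq> V \<Longrightarrow> star_vars V (starred S) = S"
  using total by (auto simp: star_vars_def starred_def restrict_map_def)

lemma starred_star_vars:
  assumes "P_le V F b a"
  shows "starred (star_vars V b) = b"
proof
  fix i
  have le: "b \<subseteq>\<^sub>m a" using assms by (rule P_le_map_le)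
  show "starred (star_vars V b) i = b i"
  proof (cases "b i")
    case None
    then show ?thesis using total by (auto simp: star_vars_def starred_def restrict_map_def)
  next
    case (Some v)
    then have "a i = b i" "i \<in> V" using le total by (force simp: map_le_def dom_def)+
    then show ?thesis using Some by (simp add: star_vars_def starred_def)
  qed
qed

lemma star_set_valid: "S \<in> star_sets \<Longrightarrow> valid V F (starred S)"
  using P_le_valid valid_a by (auto simp: star_sets_def)

text \<open>Since \<open>starred S\<close> is already below \<open>a\<close>, one further star needs
  only a single covering step, or none if \<open>i\<close> is in \<open>S\<close>. So extendability
  reduces to validity.\<close>

lemma insert_star_set:
  assumes "S \<in> star_sets" "i \<in> V"
  shows "insert i S \<in> star_sets \<longleftrightarrow> valid V F ((starred S)(i := None))"
proof
  assume "insert i S \<in> star_sets"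
  then show "valid V F ((starred S)(i := None))"
    using star_set_valid starred_insert by metis
next
  assume "valid V F ((starred S)(i := None))"
  then have "P_le V F (starred (insert i S)) a"
    using P_le_star[of V F "starred S" a i] star_set_valid[OF assms(1)] assms(1)
    by (simp add: starred_insert star_sets_def)
  then show "insert i S \<in> star_sets" using assms by (simp add: star_sets_def)
qed

text \<open>As \<open>S\<close> is nonempty, the chain from \<open>starred S\<close> up to
  \<open>a\<close> has a first step. It assigns one variable of \<open>S\<close>, and the rest of
  the chain witnesses the smaller set.\<close>

lemma star_set_accessible:
  assumes "S \<in> star_sets" "S \<noteq> {}"
  shows "\<exists>i\<in>S. S - {i} \<in> star_sets"
proof -
  have S: "S \<subseteq> V" "P_le V F (starred S) a" using assms by (auto simp: star_sets_def)
  have "starred S \<noteq> a"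
    using assms(2) star_vars_starred[OF S(1)] star_vars_starred[of "{}"] starred_empty by auto
  then obtain c where c: "covers V F c (starred S)" "P_le V F c a"
    using S(2) unfolding P_le_def by (metis (no_types, lifting) converse_rtranclpE)
  then obtain i where i: "i \<in> V" "c i \<noteq> None" "starred S = c(i := None)"
    by (auto simp: covers_def)
  have "i \<in> S" "star_vars V c = S - {i}"
    using i star_vars_starred[OF S(1)] by (auto simp: star_vars_def split: if_splits)
  then show ?thesis
    using c(2) starred_star_vars[OF c(2)] S(1) by (auto simp: star_sets_def)
qed

sublocale antimatroid V star_sets
proof
  show "finite V" by (rule finite_V)
next
  show "S \<subseteq> V" if "S \<in> star_sets" for S using that by (simp add: star_sets_def)
next
  show "\<exists>i\<in>S. S - {i} \<in> star_sets" if "S \<in> star_sets" "S \<noteq> {}" for S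
    using that by (rule star_set_accessible)
next
  show "{} \<in> star_sets" by (simp add: star_sets_def starred_empty P_le_def)
next
  fix S S' i
  assume S: "S \<in> star_sets" "S' \<in> star_sets" "S \<subseteq> S'" "insert i S \<in> star_sets"
  have i: "i \<in> V" using S(4) by (auto simp: star_sets_def)
  \<comment> \<open>More stars mean fewer assigned values, so the inclusion reverses and
    \<open>valid_star_map_le\<close> applies.\<close>
  have "starred S' \<subseteq>\<^sub>m starred S"
    using S(3) by (auto simp: starred_def map_le_def restrict_map_def)
  then have "valid V F ((starred S')(i := None))"
    using valid_star_map_le[of V F "starred S'" "starred S" i] star_set_valid[OF S(2)]
      insert_star_set[OF S(1) i] S(4) by blast
  then show "insert i S' \<in> star_sets" using insert_star_set[OF S(2) i] by blast
qed

lemma star_vars_mem_star_sets: "P_le V F b a \<Longrightarrow> star_vars V b \<in> star_sets"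
  by (auto simp: star_sets_def starred_star_vars) (simp add: star_vars_def)

lemma extensions_star_vars:
  assumes "P_le V F b a"
  shows "extensions (star_vars V b) = unconstrained_vars V F b"
  using insert_star_set[OF star_vars_mem_star_sets[OF assms]] starred_star_vars[OF assms]
  by (auto simp: extensions_def unconstrained_vars_def star_vars_def)

lemma bij_betw_star_vars: "bij_betw (star_vars V) {b. valid V F b \<and> P_le V F b a} star_sets"
  by (rule bij_betw_byWitness[where f' = starred])
    (auto simp: starred_star_vars star_vars_mem_star_sets star_set_valid star_vars_starred
      dest: star_vars_mem_star_sets, auto simp: star_sets_def star_vars_starred)

end

theorem theorem4p4:
  fixes V :: "'v set" and F :: "'v cnf" and p q :: "'v \<Rightarrow> real" and a :: "'v passign"
  assumes "finite V" and "cnf_over V F"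
    and "\<And>i. i \<in> V \<Longrightarrow> p i + q i = 1"
    and "a \<in> total_assignments V" and "satisfies a F"
  shows "(\<Sum>b\<in>{b. valid V F b \<and> P_le V F b a}.
            (\<Prod>i\<in>star_vars V b. p i) * (\<Prod>j\<in>unconstrained_vars V F b. q j)) = 1"
proof -
  interpret satisfying_assignment V F a
    using assms total_valid_iff_satisfies[of V F a]
    by unfold_locales (auto simp: total_assignments_def)
  \<comment> \<open>Writing the unconstrained variables as \<open>extensions\<close> makes each term
    depend on the star set alone, so the sum can be reindexed by star sets.\<close>
  have "(\<Sum>b\<in>{b. valid V F b \<and> P_le V F b a}. prod p (star_vars V b) * prod q (unconstrained_vars V F b))
      = (\<Sum>b\<in>{b. valid V F b \<and> P_le V F b a}. prod p (star_vars V b) * prod q (extensions (star_vars V b)))"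
    by (rule sum.cong) (auto simp: extensions_star_vars)
  also have "\<dots> = (\<Sum>S\<in>star_sets. prod p S * prod q (extensions S))"
    by (rule sum.reindex_bij_betw[OF bij_betw_star_vars])
  also have "\<dots> = 1" using assms(3) by (rule sum_prod_extensions)
  finally show ?thesis .
qed

end
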